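(* Let $G$ and $K$ be topological groups. Suppose $G$ is CAP and that $\pi\colon G\to K$ is a continuous homomorphism with dense image. Then $K$ is CAP.
   Context: All topological groups and spaces are Hausdorff. For a topological group $G$, a $G$-flow is a (non-empty) compact Hausdorff space with a continuous left action of $G$; a subflow is a non-empty closed $G$-invariant subset; a flow is minimal if it has no proper subflow. For a $G$-flow $X$, $\mathrm{AP}_G(X)=\{x\in X:\overline{Gx}\text{ is minimal}\}$. $G$ is CAP if $\mathrm{AP}_G(X)$ is closed in $X$ for every $G$-flow $X$. *)

theory Defs
  imports "HOL-Analysis.Analysis" "HOL-Algebra.Group_Action"
begin

locale topological_group = group G for G (structure) +
  fixes T :: "'g topology"
  assumes topspace_eq: "topspace T = carrier G"
    and Hausdorff: "Hausdorff_space T"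
    and continuous_mult: "continuous_map (prod_topology T T) T (\<lambda>(g, h). g \<otimes> h)"
    and continuous_inv: "continuous_map T T (\<lambda>g. inv g)"

text \<open>Spaces are carried by \<^term>\<open>topspace X\<close>, not by a whole type. A left action in the sense of
  \<^const>\<open>group_action\<close> is a homomorphism into the group of bijections of \<^term>\<open>topspace X\<close>, whose
  elements are functions equal to \<^const>\<open>undefined\<close> outside \<^term>\<open>topspace X\<close>.\<close>

definition flow ::
  "('g, 'm) monoid_scheme \<Rightarrow> 'g topology \<Rightarrow> 'x topology \<Rightarrow> ('g \<Rightarrow> 'x \<Rightarrow> 'x) \<Rightarrow> bool" where
  "flow G T X \<phi> \<longleftrightarrow>
     topspace X \<noteq> {} \<and> compact_space X \<and> Hausdorff_space X \<and>
     group_action G (topspace X) \<phi> \<and>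
     continuous_map (prod_topology T X) X (\<lambda>(g, x). \<phi> g x)"

definition subflow ::
  "('g, 'm) monoid_scheme \<Rightarrow> 'x topology \<Rightarrow> ('g \<Rightarrow> 'x \<Rightarrow> 'x) \<Rightarrow> 'x set \<Rightarrow> bool" where
  "subflow G X \<phi> Y \<longleftrightarrow>
     Y \<noteq> {} \<and> closedin X Y \<and> (\<forall>g\<in>carrier G. \<forall>y\<in>Y. \<phi> g y \<in> Y)"

definition minimal_flow ::
  "('g, 'm) monoid_scheme \<Rightarrow> 'g topology \<Rightarrow> 'x topology \<Rightarrow> ('g \<Rightarrow> 'x \<Rightarrow> 'x) \<Rightarrow> bool" where
  "minimal_flow G T X \<phi> \<longleftrightarrow> flow G T X \<phi> \<and> (\<forall>Y. subflow G X \<phi> Y \<longrightarrow> Y = topspace X)"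

text \<open>The orbit closure is a flow under the subspace topology and the restricted action; the
  restriction makes the maps extensional on the smaller carrier.\<close>

definition AP ::
  "('g, 'm) monoid_scheme \<Rightarrow> 'g topology \<Rightarrow> 'x topology \<Rightarrow> ('g \<Rightarrow> 'x \<Rightarrow> 'x) \<Rightarrow> 'x set" where
  "AP G T X \<phi> =
     {x \<in> topspace X. let C = X closure_of (orbit G \<phi> x) in
        minimal_flow G T (subtopology X C) (\<lambda>g. restrict (\<phi> g) C)}"

text \<open>HOL cannot quantify over types inside a formula, so the type \<^typ>\<open>'x\<close> in which the flows are
  carried is a parameter. Being CAP means that this holds for every \<^typ>\<open>'x\<close>.\<close>

definition CAP ::
  "'x itself \<Rightarrow> ('g, 'm) monoid_scheme \<Rightarrow> 'g topology \<Rightarrow> bool" where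
  "CAP (_ :: 'x itself) G T \<longleftrightarrow>
     (\<forall>(X :: 'x topology) \<phi>. flow G T X \<phi> \<longrightarrow> closedin X (AP G T X \<phi>))"

end

theory Submission
  imports Defs
begin

text \<open>
  A flow of \<open>K\<close> becomes a flow of \<open>G\<close> on the same space when \<open>G\<close> acts through \<open>\<pi>\<close>. For a closed set
  \<open>Y\<close> and a point \<open>x\<close>, the group elements that move \<open>x\<close> into \<open>Y\<close> form a closed subset of \<open>K\<close>, so
  they exhaust \<open>K\<close> as soon as they contain the dense subgroup \<open>\<pi>(G)\<close>
  (\<open>action_in_closed_if_dense\<close>). Hence both actions have the same closed invariant sets and the same
  orbit closures. Minimality of an orbit closure is expressible through these two data alone
  (\<open>mem_AP_iff\<close>), so both actions have the same almost periodic points, and CAP for \<open>G\<close> says that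
  they form a closed set.
\<close>

text \<open>Bijectivity is the only point with content: the inverse group element also preserves \<open>C\<close>, which
  makes the restriction onto.\<close>

lemma group_action_restrict:
  assumes "group_action G E \<phi>" and "C \<subseteq> E"
    and inv: "\<And>g x. g \<in> carrier G \<Longrightarrow> x \<in> C \<Longrightarrow> \<phi> g x \<in> C"
  shows "group_action G C (\<lambda>g. restrict (\<phi> g) C)"
proof -
  interpret group_action G E \<phi> by fact
  interpret G: group G using group_hom group_hom.axioms(1) by auto
  have Bij: "restrict (\<phi> g) C \<in> Bij C" if g: "g \<in> carrier G" for g
  proof -
    have "inj_on (\<phi> g) C"
      using inj_prop[OF g] \<open>C \<subseteq> E\<close> inj_on_subset by blast
    moreover have "\<phi> g ` C = C"
    proof
      show "C \<subseteq> \<phi> g ` C"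
      proof
        fix y assume y: "y \<in> C"
        have "\<phi> (inv\<^bsub>G\<^esub> (inv\<^bsub>G\<^esub> g)) (\<phi> (inv\<^bsub>G\<^esub> g) y) = y"
          using orbit_sym_aux[of "inv\<^bsub>G\<^esub> g" y] g y \<open>C \<subseteq> E\<close> by auto
        then show "y \<in> \<phi> g ` C"
          using g y inv[of "inv\<^bsub>G\<^esub> g" y] by (metis G.inv_closed G.inv_inv image_eqI)
      qed
    qed (use g inv in blast)
    ultimately show ?thesis
      by (simp add: Bij_def bij_betw_def inj_on_restrict_eq)
  qed
  have "restrict (\<phi> (g \<otimes>\<^bsub>G\<^esub> h)) C = compose C (restrict (\<phi> g) C) (restrict (\<phi> h) C)"
    if "g \<in> carrier G" "h \<in> carrier G" for g h
    using that composition_rule \<open>C \<subseteq> E\<close> inv by (fastforce simp: compose_def restrict_def)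
  with Bij have "(\<lambda>g. restrict (\<phi> g) C) \<in> hom G (BijGroup C)"
    by (intro homI) (auto simp: BijGroup_def)
  then show ?thesis
    by (simp add: group_action_def group_hom_def group_hom_axioms_def group_BijGroup
        G.group_axioms)
qed

lemma flow_subtopology:
  assumes "topological_group G T" and fl: "flow G T X \<phi>" and sub: "subflow G X \<phi> C"
  shows "flow G T (subtopology X C) (\<lambda>g. restrict (\<phi> g) C)"
proof -
  interpret topological_group G T by fact
  have C: "C \<noteq> {}" "closedin X C" "C \<subseteq> topspace X"
    and inv: "\<And>g x. g \<in> carrier G \<Longrightarrow> x \<in> C \<Longrightarrow> \<phi> g x \<in> C"
    using sub closedin_subset by (auto simp: subflow_def)
  have ts: "topspace (subtopology X C) = C"
    using C(3) by auto
  have "continuous_map (prod_topology T (subtopology X C)) X (\<lambda>(g, x). \<phi> g x)"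
    using fl by (auto simp: flow_def prod_topology_subtopology intro: continuous_map_from_subtopology)
  then have "continuous_map (prod_topology T (subtopology X C)) X (\<lambda>(g, x). restrict (\<phi> g) C x)"
    by (rule continuous_map_eq) auto
  then have "continuous_map (prod_topology T (subtopology X C)) (subtopology X C)
               (\<lambda>(g, x). restrict (\<phi> g) C x)"
    using inv by (auto simp: continuous_map_in_subtopology topspace_eq)
  moreover have "compact_space (subtopology X C)"
    using fl C by (simp add: flow_def closedin_compact_space compact_space_subtopology)
  ultimately show ?thesis
    using fl C(1) group_action_restrict[of G "topspace X" \<phi>, OF _ C(3) inv]
    unfolding flow_def ts by (simp add: Hausdorff_space_subtopology del: restrict_apply)
qed

lemma continuous_map_action:
  assumes "topological_group G T" and "flow G T X \<phi>" and "g \<in> carrier G"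
  shows "continuous_map X X (\<phi> g)"
proof -
  interpret topological_group G T by fact
  have "continuous_map X (prod_topology T X) (\<lambda>x. (g, x))"
    using assms(3) by (intro continuous_map_pairedI) (auto simp: topspace_eq)
  with assms(2) show ?thesis
    using continuous_map_compose[of X "prod_topology T X" "\<lambda>x. (g, x)" X "\<lambda>(g, x). \<phi> g x"]
    by (simp add: flow_def o_def)
qed

lemma continuous_map_orbit_map:
  assumes "flow G T X \<phi>" and "x \<in> topspace X"
  shows "continuous_map T X (\<lambda>g. \<phi> g x)"
proof -
  have "continuous_map T (prod_topology T X) (\<lambda>g. (g, x))"
    using assms(2) by (intro continuous_map_pairedI) auto
  with assms(1) show ?thesis
    using continuous_map_compose[of T "prod_topology T X" "\<lambda>g. (g, x)" X "\<lambda>(g, x). \<phi> g x"]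
    by (simp add: flow_def o_def)
qed

lemma orbit_subset:
  assumes "flow G T X \<phi>" and "x \<in> topspace X"
  shows "orbit G \<phi> x \<subseteq> topspace X"
  using assms group_action.element_image by (fastforce simp: flow_def orbit_def)

text \<open>Each group element maps the orbit into itself, hence by continuity also its closure.\<close>

lemma subflow_orbit_closure:
  assumes G: "topological_group G T" and fl: "flow G T X \<phi>" and x: "x \<in> topspace X"
  shows "subflow G X \<phi> (X closure_of orbit G \<phi> x)"
proof -
  interpret topological_group G T by fact
  interpret group_action G "topspace X" \<phi> using fl by (simp add: flow_def)
  have "X closure_of orbit G \<phi> x \<noteq> {}"
    using orbit_refl[OF x] closure_of_subset[OF orbit_subset[OF fl x]] by blast
  moreover have "\<phi> g y \<in> X closure_of orbit G \<phi> x"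
    if g: "g \<in> carrier G" and y: "y \<in> X closure_of orbit G \<phi> x" for g y
  proof -
    have "\<phi> g ` orbit G \<phi> x \<subseteq> orbit G \<phi> x"
      using composition_rule[OF x g, symmetric] g by (auto simp: orbit_def)
    then show ?thesis
      using continuous_map_image_closure_subset[OF continuous_map_action[OF G fl g], of "orbit G \<phi> x"]
        closure_of_mono[of "\<phi> g ` orbit G \<phi> x" "orbit G \<phi> x" X] y by blast
  qed
  ultimately show ?thesis by (simp add: subflow_def)
qed

text \<open>Orbit closures are always flows, so minimality of one only concerns the subflows of the ambient
  space. In this form the restricted action and the topology of the group disappear.\<close>

lemma mem_AP_iff:
  assumes G: "topological_group G T" and fl: "flow G T X \<phi>" and x: "x \<in> topspace X"
  shows "x \<in> AP G T X \<phi> \<longleftrightarrow>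
    (\<forall>Y. subflow G X \<phi> Y \<longrightarrow> Y \<subseteq> X closure_of orbit G \<phi> x \<longrightarrow> Y = X closure_of orbit G \<phi> x)"
proof -
  define C where "C = X closure_of orbit G \<phi> x"
  have sub: "subflow G X \<phi> C"
    unfolding C_def using subflow_orbit_closure[OF G fl x] .
  then have "closedin X C" by (simp add: subflow_def)
  then have "C \<subseteq> topspace X" by (rule closedin_subset)
  have "subflow G (subtopology X C) (\<lambda>g. restrict (\<phi> g) C) Y \<longleftrightarrow> subflow G X \<phi> Y \<and> Y \<subseteq> C" for Y
    unfolding subflow_def closedin_closed_subtopology[OF \<open>closedin X C\<close>] by (auto simp: subset_iff)
  then show ?thesis
    using flow_subtopology[OF G fl sub] x \<open>C \<subseteq> topspace X\<close>
    by (auto simp: AP_def minimal_flow_def Let_def C_def[symmetric] Int_absorb1)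
qed

text \<open>The orbit map of \<open>x\<close> is continuous, so the preimage of \<open>Y\<close> under it is closed. The set \<open>D\<close>
  stands for the image of a homomorphism with dense range.\<close>

lemma action_in_closed_if_dense:
  assumes "topological_group K T" and fl: "flow K T X \<phi>"
    and dense: "T closure_of D = topspace T"
    and Y: "closedin X Y" and x: "x \<in> topspace X"
    and D: "D \<subseteq> carrier K" "\<And>d. d \<in> D \<Longrightarrow> \<phi> d x \<in> Y" and k: "k \<in> carrier K"
  shows "\<phi> k x \<in> Y"
proof -
  interpret topological_group K T by fact
  have "closedin T {k \<in> topspace T. \<phi> k x \<in> Y}"
    using closedin_continuous_map_preimage[OF continuous_map_orbit_map[OF fl x] Y] .
  then have "T closure_of D \<subseteq> {k \<in> topspace T. \<phi> k x \<in> Y}"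
    using D topspace_eq by (intro closure_of_minimal) auto
  then show ?thesis
    using k dense topspace_eq by auto
qed

lemma flow_compose_hom:
  assumes "topological_group G S" and fl: "flow K T X \<phi>"
    and hom: "\<pi> \<in> hom G K" and cont: "continuous_map S T \<pi>"
  shows "flow G S X (\<phi> \<circ> \<pi>)"
proof -
  interpret topological_group G S by fact
  have "group_hom K (BijGroup (topspace X)) \<phi>"
    using fl by (simp add: flow_def group_action_def)
  then have "\<phi> \<in> hom K (BijGroup (topspace X))"
    by (simp add: group_hom_def group_hom_axioms_def)
  then have "\<phi> \<circ> \<pi> \<in> hom G (BijGroup (topspace X))"
    using Group.hom_compose[OF hom] by blast
  then have "group_action G (topspace X) (\<phi> \<circ> \<pi>)"
    by (simp add: group_action_def group_hom_def group_hom_axioms_def group_BijGroup is_group)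
  moreover have "continuous_map (prod_topology S X) (prod_topology T X) (\<lambda>(g, x). (\<pi> g, x))"
    using cont by (simp add: continuous_map_prod_top)
  then have "continuous_map (prod_topology S X) X (\<lambda>(g, x). (\<phi> \<circ> \<pi>) g x)"
    using continuous_map_compose[of _ _ _ X "\<lambda>(k, x). \<phi> k x"] fl
    by (fastforce simp: flow_def o_def case_prod_unfold)
  ultimately show ?thesis
    using fl by (simp add: flow_def)
qed

lemma subflow_compose_dense_hom_iff:
  assumes "topological_group K T" and "flow K T X \<phi>" and hom: "\<pi> \<in> hom G K"
    and "T closure_of (\<pi> ` carrier G) = topspace T"
  shows "subflow G X (\<phi> \<circ> \<pi>) Y \<longleftrightarrow> subflow K X \<phi> Y"
proof
  assume sub: "subflow G X (\<phi> \<circ> \<pi>) Y"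
  then have Y: "closedin X Y" by (simp add: subflow_def)
  have "\<phi> k y \<in> Y" if k: "k \<in> carrier K" and y: "y \<in> Y" for k y
  proof (rule action_in_closed_if_dense[OF assms(1,2,4) Y _ _ _ k])
    show "y \<in> topspace X"
      using closedin_subset[OF Y] y by blast
    show "\<pi> ` carrier G \<subseteq> carrier K"
      using hom by (auto simp: hom_def)
    show "\<phi> d y \<in> Y" if "d \<in> \<pi> ` carrier G" for d
      using that sub y by (auto simp: subflow_def)
  qed
  then show "subflow K X \<phi> Y"
    using sub by (simp add: subflow_def)
next
  assume "subflow K X \<phi> Y"
  then show "subflow G X (\<phi> \<circ> \<pi>) Y"
    using hom by (auto simp: subflow_def hom_def)
qed

text \<open>An orbit of \<open>K\<close> may be strictly larger than the orbit of \<open>G\<close> through the same point, but it cannot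
  leave the closure of the latter.\<close>

lemma orbit_closure_compose_dense_hom:
  assumes "topological_group K T" and fl: "flow K T X \<phi>" and hom: "\<pi> \<in> hom G K"
    and "T closure_of (\<pi> ` carrier G) = topspace T" and x: "x \<in> topspace X"
  shows "X closure_of orbit G (\<phi> \<circ> \<pi>) x = X closure_of orbit K \<phi> x"
proof
  have sub: "orbit G (\<phi> \<circ> \<pi>) x \<subseteq> orbit K \<phi> x"
    using hom by (auto simp: orbit_def hom_def)
  then show "X closure_of orbit G (\<phi> \<circ> \<pi>) x \<subseteq> X closure_of orbit K \<phi> x"
    by (rule closure_of_mono)
  have G_orbit: "orbit G (\<phi> \<circ> \<pi>) x \<subseteq> X closure_of orbit G (\<phi> \<circ> \<pi>) x"
    using sub orbit_subset[OF fl x] by (intro closure_of_subset) auto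
  have "\<phi> k x \<in> X closure_of orbit G (\<phi> \<circ> \<pi>) x" if "k \<in> carrier K" for k
  proof (rule action_in_closed_if_dense[OF assms(1,2,4) closedin_closure_of x _ _ that])
    show "\<pi> ` carrier G \<subseteq> carrier K"
      using hom by (auto simp: hom_def)
    show "\<phi> d x \<in> X closure_of orbit G (\<phi> \<circ> \<pi>) x" if "d \<in> \<pi> ` carrier G" for d
      using that by (intro subsetD[OF G_orbit]) (auto simp: orbit_def)
  qed
  then show "X closure_of orbit K \<phi> x \<subseteq> X closure_of orbit G (\<phi> \<circ> \<pi>) x"
    by (intro closure_of_minimal closedin_closure_of) (auto simp only: orbit_def)
qed

theorem proposition7p1:
  fixes G :: "('g, 'm) monoid_scheme" and S :: "'g topology"
    and K :: "('k, 'n) monoid_scheme" and T :: "'k topology"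
    and \<pi> :: "'g \<Rightarrow> 'k"
  assumes "topological_group G S"
    and "topological_group K T"
    and "CAP TYPE('x) G S"
    and "\<pi> \<in> hom G K"
    and "continuous_map S T \<pi>"
    and "T closure_of (\<pi> ` carrier G) = topspace T"
  shows "CAP TYPE('x) K T"
  unfolding CAP_def
proof (intro allI impI)
  fix X :: "'x topology" and \<phi>
  assume K_flow: "flow K T X \<phi>"
  have G_flow: "flow G S X (\<phi> \<circ> \<pi>)"
    using flow_compose_hom[OF assms(1) K_flow assms(4,5)] .
  have "x \<in> AP G S X (\<phi> \<circ> \<pi>) \<longleftrightarrow> x \<in> AP K T X \<phi>" if "x \<in> topspace X" for x
    unfolding mem_AP_iff[OF assms(1) G_flow that] mem_AP_iff[OF assms(2) K_flow that]
      orbit_closure_compose_dense_hom[OF assms(2) K_flow assms(4,6) that]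
      subflow_compose_dense_hom_iff[OF assms(2) K_flow assms(4,6)] ..
  then have "AP G S X (\<phi> \<circ> \<pi>) = AP K T X \<phi>"
    by (auto simp: AP_def)
  then show "closedin X (AP K T X \<phi>)"
    using assms(3) G_flow by (metis CAP_def)
qed

end
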